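(* Let $\rho\in(-1,1)$ and $\alpha\in(0,1)$. Then: (1) The complement $\mathcal R_\alpha^c$ of the rejection region is symmetric with respect to the two diagonals $\Delta_0^{+1}$ and $\Delta_0^{-1}$, and $\mathcal R_\alpha^c\cap\Delta_u^\varepsilon$ is an interval for all $u\in\mathbb R$ and $\varepsilon=\pm1$. Consequently, the power $\pi(\mu_1,\mu_2):=\mathbb P\{\mathcal N((\mu_1,\mu_2),R(\rho))\in\mathcal R_\alpha\}$ of the Spacing test for LARS is non-decreasing along the half diagonals: for every $u\in\mathbb R$, the two functions of $z\ge0$ $$z\mapsto\pi(u/2-z,\,u/2+z)=\pi(u/2+z,\,u/2-z),$$ $$z\mapsto\pi(u/2+z,\,-u/2+z)=\pi(u/2-z,\,-u/2-z)$$ are non-decreasing. In particular: (2) the Spacing test for LARS is unbiased, i.e. $\pi(\mu)\ge\alpha$ for every $\mu\in\mathbb R^2\setminus\{0\}$; (3) for each $\mu\in\mathbb R^2$, the function $t\mapsto\pi(t\mu)=\mathbb P_{t\mu}(S\le\alpha)$ is non-decreasing on $t\ge0$.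
   Context: Two-predictor case: $p=2$, and the correlation vector is $U=(U_1,U_2)\sim\mathcal N_2(\mu,R(\rho))$ under $\mathbb P_\mu$, $\mu\in\mathbb R^2$, with $$R(\rho)=\begin{pmatrix}1&\rho\\ \rho&1\end{pmatrix}.$$ For $U\in\mathbb R^2$, let $(\hat\imath,\hat\varepsilon)\in\{1,2\}\times\{\pm1\}$ be such that $\hat\varepsilon U_{\hat\imath}=\max(|U_1|,|U_2|)$ (if several pairs qualify, the value of $S$ below does not depend on the choice), let $j$ be the element of $\{1,2\}$ other than $\hat\imath$, and set $$\lambda_1:=\hat\varepsilon U_{\hat\imath},\qquad \lambda_2:=\max\Big\{\frac{U_j-\rho U_{\hat\imath}}{1-\hat\varepsilon\rho},\ \frac{-U_j+\rho U_{\hat\imath}}{1+\hat\varepsilon\rho}\Big\},\qquad S=S(U):=\frac{\bar\Phi(\lambda_1)}{\bar\Phi(\lambda_2)},$$ where $\bar\Phi=1-\Phi$ and $\Phi$ is the standard normal cumulative distribution function. The Spacing test for LARS of level $\alpha$ tests $\mu=0$ against $\mu\neq0$ and rejects $\mu=0$ when $S\le\alpha$; its rejection region is $\mathcal R_\alpha:=\{U\in\mathbb R^2:\ S(U)\le\alpha\}$. For $u\in\mathbb R$ and $\varepsilon=\pm1$, $\Delta_u^\varepsilon:=\{(x,y)\in\mathbb R^2:\ y=\varepsilon x+u\}$. *)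

theory Defs
  imports "HOL-Probability.Probability"
begin

text \<open>The bivariate normal law with mean \<open>\<mu>\<close>, unit variances and correlation \<open>\<rho>\<close>, given by its
  Lebesgue density; the quadratic form is that of the inverse of the covariance matrix
  with rows \<open>(1, \<rho>)\<close> and \<open>(\<rho>, 1)\<close>, whose determinant is \<open>1 - \<rho>\<^sup>2\<close>. Meaningful for
  \<open>-1 < \<rho> < 1\<close>.\<close>

definition bivariate_normal_density :: "real \<Rightarrow> real \<times> real \<Rightarrow> real \<times> real \<Rightarrow> real" where
  "bivariate_normal_density \<rho> \<mu> x =
     exp (- ((fst x - fst \<mu>)\<^sup>2 - 2 * \<rho> * (fst x - fst \<mu>) * (snd x - snd \<mu>) + (snd x - snd \<mu>)\<^sup>2)
            / (2 * (1 - \<rho>\<^sup>2)))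
       / (2 * pi * sqrt (1 - \<rho>\<^sup>2))"

definition bivariate_normal :: "real \<Rightarrow> real \<times> real \<Rightarrow> (real \<times> real) measure" where
  "bivariate_normal \<rho> \<mu> = density lborel (\<lambda>x. ennreal (bivariate_normal_density \<rho> \<mu> x))"

text \<open>Marginal times conditional density: a check on the formula above.\<close>

lemma bivariate_normal_density_factor:
  assumes "-1 < \<rho>" "\<rho> < 1"
  shows "bivariate_normal_density \<rho> (m, n) (x, y) =
    normal_density m 1 x * normal_density (n + \<rho> * (x - m)) (sqrt (1 - \<rho>\<^sup>2)) y"
proof -
  define a b D where "a = x - m" and "b = y - n" and D: "D = 1 - \<rho>\<^sup>2"
  have "D > 0"
    unfolding D using assms by (simp add: abs_square_less_1)
  have y: "y - (n + \<rho> * (x - m)) = b - \<rho> * a"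
    by (simp add: a_def b_def)
  have "a\<^sup>2 - 2 * \<rho> * a * b + b\<^sup>2 = a\<^sup>2 * D + (b - \<rho> * a)\<^sup>2"
    by (simp add: D power2_eq_square algebra_simps)
  then have "- (a\<^sup>2 - 2 * \<rho> * a * b + b\<^sup>2) / (2 * D) = - (a\<^sup>2 / 2) + - ((b - \<rho> * a)\<^sup>2 / (2 * D))"
    using \<open>D > 0\<close> by (simp add: field_simps)
  then have e: "exp (- (a\<^sup>2 - 2 * \<rho> * a * b + b\<^sup>2) / (2 * D)) =
      exp (- (a\<^sup>2 / 2)) * exp (- ((b - \<rho> * a)\<^sup>2 / (2 * D)))"
    by (simp only: exp_add)
  have s: "2 * pi * sqrt D = sqrt (2 * pi) * sqrt (2 * pi * D)"
    by (simp add: real_sqrt_mult[of "2 * pi" D] flip: mult.assoc)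
  have "bivariate_normal_density \<rho> (m, n) (x, y) =
      exp (- (a\<^sup>2 - 2 * \<rho> * a * b + b\<^sup>2) / (2 * D)) / (2 * pi * sqrt D)"
    by (simp only: bivariate_normal_density_def fst_conv snd_conv a_def b_def D)
  also have "\<dots> = (exp (- (a\<^sup>2 / 2)) / sqrt (2 * pi)) *
      (exp (- ((b - \<rho> * a)\<^sup>2 / (2 * D))) / sqrt (2 * pi * D))"
    by (simp only: e s times_divide_times_eq)
  also have "\<dots> = normal_density m 1 x * normal_density (n + \<rho> * (x - m)) (sqrt D) y"
    using \<open>D > 0\<close> by (simp add: normal_density_def y) (simp add: a_def)
  finally show ?thesis
    by (simp only: D)
qed

definition Phi_bar :: "real \<Rightarrow> real" where
  "Phi_bar x = 1 - cdf std_normal_distribution x"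

definition coord :: "real \<times> real \<Rightarrow> nat \<Rightarrow> real" where
  "coord U i = (if i = 1 then fst U else snd U)"

text \<open>\<open>leading U (i, \<epsilon>)\<close>: the variable of index \<open>i\<close>, with sign \<open>\<epsilon>\<close>, may enter first.\<close>

definition leading :: "real \<times> real \<Rightarrow> nat \<times> real \<Rightarrow> bool" where
  "leading U = (\<lambda>(i, \<epsilon>). i \<in> {1, 2} \<and> \<epsilon> \<in> {-1, 1} \<and>
     \<epsilon> * coord U i = max \<bar>coord U 1\<bar> \<bar>coord U 2\<bar>)"

definition knot1 :: "real \<times> real \<Rightarrow> nat \<times> real \<Rightarrow> real" where
  "knot1 U = (\<lambda>(i, \<epsilon>). \<epsilon> * coord U i)"

text \<open>The index in \<open>{1, 2}\<close> other than \<open>i\<close> is \<open>3 - i\<close>.\<close>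

definition knot2 :: "real \<Rightarrow> real \<times> real \<Rightarrow> nat \<times> real \<Rightarrow> real" where
  "knot2 \<rho> U = (\<lambda>(i, \<epsilon>). let j = 3 - i in
     max ((coord U j - \<rho> * coord U i) / (1 - \<epsilon> * \<rho>))
         ((- coord U j + \<rho> * coord U i) / (1 + \<epsilon> * \<rho>)))"

definition spacing_stat :: "real \<Rightarrow> real \<times> real \<Rightarrow> real" where
  "spacing_stat \<rho> U = (let p = (SOME p. leading U p) in
     Phi_bar (knot1 U p) / Phi_bar (knot2 \<rho> U p))"

text \<open>A leading pair always exists, and the choice among several does not affect the value.\<close>

lemma leading_exists: "\<exists>p. leading U p"
proof -
  have "leading U (1, 1) \<or> leading U (1, -1) \<or> leading U (2, 1) \<or> leading U (2, -1)"
    unfolding leading_def by (auto simp: max_def abs_if split: if_splits)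
  then show ?thesis by blast
qed

lemma knot2_tie:
  assumes "-1 < \<rho>" "\<rho> < 1" "leading U p" "\<bar>fst U\<bar> = \<bar>snd U\<bar>"
  shows "knot2 \<rho> U p = \<bar>fst U\<bar>"
proof -
  obtain i \<epsilon> where p: "p = (i, \<epsilon>)" by (cases p)
  define a b c where "a = coord U i" and "b = coord U (3 - i)" and "c = \<bar>fst U\<bar>"
  have i: "i = 1 \<or> i = 2" and \<epsilon>: "\<epsilon> = 1 \<or> \<epsilon> = -1"
    and "\<epsilon> * a = max \<bar>fst U\<bar> \<bar>snd U\<bar>"
    using assms(3) unfolding leading_def p a_def by (auto simp: coord_def)
  then have ea: "\<epsilon> * a = c"
    using assms(4) by (simp add: c_def)
  have a: "a = \<epsilon> * c"
    using \<epsilon> unfolding ea[symmetric] by auto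
  have "\<bar>b\<bar> = c"
    using i assms(4) unfolding b_def c_def coord_def by auto
  then have b: "b = c \<or> b = - c" and c: "c \<ge> 0" by auto
  have L: "1 - \<rho> > 0" "1 + \<rho> > 0" using assms by auto
  have e: "(c - \<rho> * c) / (1 - \<rho>) = c" "(c + \<rho> * c) / (1 + \<rho>) = c"
    using L by (simp_all add: nonzero_divide_eq_eq right_diff_distrib distrib_left mult.commute)
  have l: "(- c + \<rho> * c) / (1 + \<rho>) \<le> c" "(- c - \<rho> * c) / (1 - \<rho>) \<le> c"
    using L c by (simp_all add: pos_divide_le_eq right_diff_distrib distrib_left mult.commute)
  have k: "knot2 \<rho> U p = max ((b - \<rho> * a) / (1 - \<epsilon> * \<rho>)) ((- b + \<rho> * a) / (1 + \<epsilon> * \<rho>))"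
    by (simp add: knot2_def p a_def b_def Let_def)
  consider "\<epsilon> = 1" "b = c" | "\<epsilon> = 1" "b = - c" | "\<epsilon> = -1" "b = c" | "\<epsilon> = -1" "b = - c"
    using \<epsilon> b by blast
  then have "knot2 \<rho> U p = c"
    using e l unfolding k a by cases (simp_all add: max_def)
  then show ?thesis by (simp add: c_def)
qed

lemma knot2_leading_unique:
  assumes "-1 < \<rho>" "\<rho> < 1" "leading U p" "leading U q"
  shows "knot2 \<rho> U p = knot2 \<rho> U q"
proof (cases "\<bar>fst U\<bar> = \<bar>snd U\<bar>")
  case True
  then show ?thesis using knot2_tie assms by metis
next
  case False
  have "p = q"
    using assms(3,4) False unfolding leading_def
    by (cases p; cases q) (auto simp: coord_def max_def abs_if split: if_splits)
  then show ?thesis by simp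
qed

lemma spacing_stat_eq:
  assumes "-1 < \<rho>" "\<rho> < 1" "leading U p"
  shows "spacing_stat \<rho> U = Phi_bar (knot1 U p) / Phi_bar (knot2 \<rho> U p)"
proof -
  define q where "q = (SOME q. leading U q)"
  have q: "leading U q"
    unfolding q_def using assms(3) by (rule someI)
  have "knot1 U q = knot1 U p"
    using q assms(3) unfolding leading_def knot1_def case_prod_unfold by simp
  moreover have "knot2 \<rho> U q = knot2 \<rho> U p"
    using assms q by (intro knot2_leading_unique)
  ultimately show ?thesis
    by (simp add: spacing_stat_def q_def[symmetric])
qed

definition rejection_region :: "real \<Rightarrow> real \<Rightarrow> (real \<times> real) set" where
  "rejection_region \<rho> \<alpha> = {U. spacing_stat \<rho> U \<le> \<alpha>}"

definition spacing_power :: "real \<Rightarrow> real \<Rightarrow> real \<times> real \<Rightarrow> real" where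
  "spacing_power \<rho> \<alpha> \<mu> = measure (bivariate_normal \<rho> \<mu>) (rejection_region \<rho> \<alpha>)"

definition diag_line :: "real \<Rightarrow> real \<Rightarrow> (real \<times> real) set" where
  "diag_line \<epsilon> u = {(x, y). y = \<epsilon> * x + u}"

text \<open>For \<open>\<epsilon> = 1\<close> and \<open>\<epsilon> = -1\<close>, the orthogonal reflection in the line \<open>diag_line \<epsilon> 0\<close>.\<close>

definition diag_reflection :: "real \<Rightarrow> real \<times> real \<Rightarrow> real \<times> real" where
  "diag_reflection \<epsilon> = (\<lambda>(x, y). (\<epsilon> * y, \<epsilon> * x))"

end

theory Submission
  imports Defs
begin

text \<open>
  Everything depends on \<open>U = (x, y)\<close> only through the diagonal coordinates. The statistic is a
  function of \<open>a = \<bar>x + y\<bar>\<close> and \<open>b = \<bar>x - y\<bar>\<close> (\<open>spacing_stat_diag\<close>), and the variables \<open>x + y\<close>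
  and \<open>x - y\<close> are independent normal variables (\<open>bivariate_normal_density_diag\<close>).

  The statistic is nonincreasing in each of \<open>a\<close> and \<open>b\<close> (\<open>diag_stat_antimono\<close>). Moving along a diagonal
  raises both knots by equal amounts at worst, and for knots with a fixed gap the ratio of the Gaussian
  tails decreases because the tail function is log-concave (\<open>Phi_bar_shift_ratio_antimono\<close>). This gives
  the symmetry of the acceptance region and the fact that it meets every diagonal line in an interval.

  The power is then monotone in \<open>\<bar>\<mu>\<^sub>1 + \<mu>\<^sub>2\<bar>\<close> and in \<open>\<bar>\<mu>\<^sub>1 - \<mu>\<^sub>2\<bar>\<close> (\<open>spacing_power_mono\<close>). The comparison
  of two means that differ along one diagonal direction uses the reflection that exchanges them: it
  shows that a set whose sections in that direction are complements of symmetric intervals gains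
  probability as the mean moves away from the centre (\<open>emeasure_bivariate_normal_mono_diag\<close>). This
  is a two-dimensional form of Anderson's inequality in dimension one. The half diagonals and the rays
  \<open>t \<mapsto> t \<mu>\<close> are paths on which both absolute values are nondecreasing.

  Unbiasedness follows since the mean \<open>0\<close> minimises the power and the level is exactly \<open>\<alpha>\<close> there
  (\<open>spacing_power_null\<close>). By symmetry one may assume that the first variable leads with positive sign.
  Given the residual of \<open>y\<close> after regression on \<open>x\<close>, the second knot is a constant \<open>l\<close>, and \<open>x\<close> is a
  standard normal variable conditioned to exceed \<open>l\<close>, so the statistic is uniform on \<open>(0, 1)\<close>
  (\<open>emeasure_rejection_sector\<close>).
\<close>

section \<open>The Gaussian tail\<close>

lemma prob_space_std_normal: "prob_space std_normal_distribution"
  using real_dist_normal_dist by (simp add: real_distribution_def)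

lemma emeasure_std_normal:
  assumes "A \<in> sets borel"
  shows "emeasure std_normal_distribution A
    = (\<integral>\<^sup>+x. ennreal (normal_density 0 1 x) * indicator A x \<partial>lborel)"
  using assms by (subst emeasure_density) auto

lemma measure_std_normal_Ioc_pos:
  assumes "a < b"
  shows "measure std_normal_distribution {a<..b} > 0"
proof -
  interpret prob_space std_normal_distribution by (rule prob_space_std_normal)
  have "measure std_normal_distribution {a<..b} \<noteq> 0"
  proof
    assume "measure std_normal_distribution {a<..b} = 0"
    then have "{a<..b} \<in> null_sets std_normal_distribution"
      by (auto simp: null_sets_def emeasure_eq_measure)
    then have "AE x in lborel. x \<in> {a<..b} \<longrightarrow> ennreal (normal_density 0 1 x) = 0"
      by (subst (asm) null_sets_density_iff) auto
    then have "AE x in lborel. x \<notin> {a<..b}"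
      by eventually_elim (metis ennreal_eq_0_iff normal_density_pos not_le zero_less_one)
    then have "{a<..b} \<in> null_sets lborel"
      by (subst (asm) AE_iff_null_sets[symmetric]) auto
    then show False using assms by (auto simp: null_sets_def)
  qed
  then show ?thesis by (simp add: zero_less_measure_iff)
qed

lemma Phi_bar_eq_measure: "Phi_bar t = measure std_normal_distribution {t<..}"
proof -
  interpret prob_space std_normal_distribution by (rule prob_space_std_normal)
  have "measure std_normal_distribution (space std_normal_distribution - {..t}) =
      1 - measure std_normal_distribution {..t}"
    by (intro prob_compl) auto
  also have "space std_normal_distribution - {..t} = {t<..}" by auto
  finally show ?thesis by (simp add: Phi_bar_def cdf_def)
qed

lemma Phi_bar_diff:
  assumes "s \<le> t"
  shows "Phi_bar s - Phi_bar t = measure std_normal_distribution {s<..t}"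
proof -
  interpret prob_space std_normal_distribution by (rule prob_space_std_normal)
  have "{s<..t} \<union> {t<..} = {s<..}" using assms by auto
  then show ?thesis
    using finite_measure_Union[of "{s<..t}" "{t<..}"]
    by (simp add: Phi_bar_eq_measure ivl_disj_int)
qed

lemma Phi_bar_strict_antimono: "s < t \<Longrightarrow> Phi_bar t < Phi_bar s"
  using Phi_bar_diff[of s t] measure_std_normal_Ioc_pos[of s t] by simp

lemma Phi_bar_le_iff: "Phi_bar s \<le> Phi_bar t \<longleftrightarrow> t \<le> s"
  by (metis Phi_bar_strict_antimono linorder_not_le nle_le)

lemma Phi_bar_pos: "Phi_bar t > 0"
proof -
  have "0 \<le> Phi_bar (t + 1)" by (simp add: Phi_bar_eq_measure)
  also have "\<dots> < Phi_bar t" by (intro Phi_bar_strict_antimono) simp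
  finally show ?thesis .
qed

lemma measure_std_normal_singleton: "measure std_normal_distribution {x} = 0"
proof -
  have "{x} \<in> null_sets std_normal_distribution"
  proof (subst null_sets_density_iff)
    have "AE y in lborel. y \<in> {x} \<longrightarrow> ennreal (normal_density 0 1 y) = 0"
      using AE_lborel_singleton[of x] by eventually_elim simp
    then show "{x} \<in> sets lborel \<and> (AE y in lborel. y \<in> {x} \<longrightarrow> ennreal (normal_density 0 1 y) = 0)"
      by simp
  qed auto
  then show ?thesis by (auto simp: null_sets_def measure_def)
qed

lemma isCont_Phi_bar: "isCont Phi_bar x"
proof -
  interpret real_distribution std_normal_distribution by (rule real_dist_normal_dist)
  have "isCont (cdf std_normal_distribution) x"
    by (simp add: isCont_cdf measure_std_normal_singleton)
  then show ?thesis unfolding Phi_bar_def[abs_def] by (intro continuous_intros)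
qed

lemma continuous_on_Phi_bar [continuous_intros]:
  "continuous_on S f \<Longrightarrow> continuous_on S (\<lambda>x. Phi_bar (f x))"
  by (rule continuous_on_compose2[of UNIV Phi_bar])
     (auto intro: continuous_at_imp_continuous_on isCont_Phi_bar)

lemma Phi_bar_tendsto_0: "(Phi_bar \<longlongrightarrow> 0) at_top"
proof -
  interpret real_distribution std_normal_distribution by (rule real_dist_normal_dist)
  have "((\<lambda>x. 1 - cdf std_normal_distribution x) \<longlongrightarrow> 1 - 1) at_top"
    by (intro tendsto_intros cdf_lim_at_top_prob)
  then show ?thesis by (simp add: Phi_bar_def[abs_def])
qed

text \<open>The probability integral transform on a tail: \<^term>\<open>Phi_bar\<close> attains the value \<open>p\<close> at some
  \<open>q > l\<close>, so the event is a half line starting at \<open>q\<close>. With \<open>p = \<alpha> * Phi_bar l\<close> this says that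
  a standard normal variable conditioned to exceed \<open>l\<close> satisfies \<open>Phi_bar x / Phi_bar l \<le> \<alpha>\<close> with
  probability \<open>\<alpha>\<close>.\<close>

lemma emeasure_std_normal_Phi_bar_le:
  assumes "0 < p" "p < Phi_bar l"
  shows "emeasure std_normal_distribution {x. l < x \<and> Phi_bar x \<le> p} = ennreal p"
proof -
  interpret real_distribution std_normal_distribution by (rule real_dist_normal_dist)
  have "eventually (\<lambda>x. Phi_bar x < p) at_top"
    using Phi_bar_tendsto_0 \<open>0 < p\<close> by (rule order_tendstoD)
  then obtain u where u: "Phi_bar u < p" by (auto simp: eventually_at_top_linorder)
  then have "Phi_bar u \<le> Phi_bar l" using assms by simp
  then have "l \<le> u" by (simp only: Phi_bar_le_iff)
  then obtain q where q: "l \<le> q" "Phi_bar q = p"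
    using IVT2[of Phi_bar u p l] u assms isCont_Phi_bar by (auto dest: less_imp_le)
  have "l < q" using q assms by (cases "l = q") auto
  have "{x. l < x \<and> Phi_bar x \<le> p} = insert q {q<..}"
    using \<open>l < q\<close> by (auto simp: q(2)[symmetric] Phi_bar_le_iff)
  moreover have "measure std_normal_distribution (insert q {q<..}) = p"
    using finite_measure_Union[of "{q}" "{q<..}"] measure_std_normal_singleton q
    by (simp add: Phi_bar_eq_measure)
  ultimately show ?thesis by (simp add: emeasure_eq_measure)
qed

lemma std_normal_density_shift:
  "normal_density 0 1 (c + x) = exp (- c * x - c\<^sup>2 / 2) * normal_density 0 1 x"
  by (simp add: normal_density_def power2_eq_square field_simps flip: exp_add)

text \<open>Completing the square: translating by \<open>c\<close> reweights the standard normal law by the factor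
  \<open>exp (- c * x - c\<^sup>2 / 2)\<close>. For \<open>c \<ge> 0\<close> the weight decreases in \<open>x\<close>, so its value at \<open>t\<close> bounds it
  from above on the right of \<open>t\<close> and from below on the left.\<close>

lemma emeasure_std_normal_shift:
  assumes [measurable]: "A \<in> sets borel"
  shows "emeasure std_normal_distribution {x. x - c \<in> A} =
    (\<integral>\<^sup>+x. ennreal (exp (- c * x - c\<^sup>2 / 2)) * (ennreal (normal_density 0 1 x) * indicator A x) \<partial>lborel)"
proof -
  have "emeasure std_normal_distribution {x. x - c \<in> A} =
      (\<integral>\<^sup>+x. ennreal (normal_density 0 1 x) * indicator A (x - c) \<partial>lborel)"
    by (subst emeasure_std_normal) (auto intro!: nn_integral_cong simp: indicator_def)
  also have "\<dots> = (\<integral>\<^sup>+x. ennreal (normal_density 0 1 (c + x)) * indicator A x \<partial>lborel)"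
    by (subst nn_integral_real_affine[where c = 1 and t = c]) auto
  finally show ?thesis
    by (simp add: std_normal_density_shift ennreal_mult mult.assoc)
qed

lemma measure_std_normal_shift_le:
  assumes [measurable]: "A \<in> sets borel" and "A \<subseteq> {t..}" "0 \<le> c"
  shows "measure std_normal_distribution {x. x - c \<in> A}
    \<le> exp (- c * t - c\<^sup>2 / 2) * measure std_normal_distribution A"
proof -
  interpret prob_space std_normal_distribution by (rule prob_space_std_normal)
  have "emeasure std_normal_distribution {x. x - c \<in> A} \<le>
    (\<integral>\<^sup>+x. ennreal (exp (- c * t - c\<^sup>2 / 2)) * (ennreal (normal_density 0 1 x) * indicator A x) \<partial>lborel)"
    unfolding emeasure_std_normal_shift[OF assms(1)] using assms
    by (intro nn_integral_mono)
       (auto simp: indicator_def intro!: mult_right_mono ennreal_leI mult_left_mono)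
  also have "\<dots> = ennreal (exp (- c * t - c\<^sup>2 / 2)) * emeasure std_normal_distribution A"
    by (subst nn_integral_cmult) (auto simp: emeasure_std_normal)
  finally show ?thesis
    by (simp add: emeasure_eq_measure flip: ennreal_mult)
qed

lemma measure_std_normal_shift_ge:
  assumes [measurable]: "A \<in> sets borel" and "A \<subseteq> {..t}" "0 \<le> c"
  shows "exp (- c * t - c\<^sup>2 / 2) * measure std_normal_distribution A
    \<le> measure std_normal_distribution {x. x - c \<in> A}"
proof -
  interpret prob_space std_normal_distribution by (rule prob_space_std_normal)
  have "ennreal (exp (- c * t - c\<^sup>2 / 2)) * emeasure std_normal_distribution A =
    (\<integral>\<^sup>+x. ennreal (exp (- c * t - c\<^sup>2 / 2)) * (ennreal (normal_density 0 1 x) * indicator A x) \<partial>lborel)"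
    by (subst nn_integral_cmult) (auto simp: emeasure_std_normal)
  also have "\<dots> \<le> emeasure std_normal_distribution {x. x - c \<in> A}"
    unfolding emeasure_std_normal_shift[OF assms(1)] using assms
    by (intro nn_integral_mono)
       (auto simp: indicator_def intro!: mult_right_mono ennreal_leI mult_left_mono)
  finally show ?thesis
    by (simp add: emeasure_eq_measure flip: ennreal_mult)
qed

text \<open>Log-concavity of \<^term>\<open>Phi_bar\<close>: \<open>Phi_bar (t + c) / Phi_bar t\<close> is the mean of the weight
  \<open>exp (- c * x - c\<^sup>2 / 2)\<close> over \<open>x > t\<close>. Lowering \<open>t\<close> to \<open>s\<close> adds only points where the weight is at
  least its value \<open>g\<close> at \<open>t\<close>, and \<open>g\<close> bounds the old mean, so the mean does not drop.\<close>

lemma Phi_bar_shift_ratio_antimono: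
  assumes "s \<le> t" "0 \<le> c"
  shows "Phi_bar (t + c) * Phi_bar s \<le> Phi_bar (s + c) * Phi_bar t"
proof -
  define g where "g = exp (- c * t - c\<^sup>2 / 2)"
  have "{x. x - c \<in> {t<..}} = {t + c<..}" "{x. x - c \<in> {s<..t}} = {s + c<..t + c}"
    by (auto simp: algebra_simps)
  moreover have "{t<..} \<subseteq> {t..}" "{s<..t} \<subseteq> {..t}" by auto
  ultimately have 1: "Phi_bar (t + c) \<le> g * Phi_bar t"
    and 2: "g * (Phi_bar s - Phi_bar t) \<le> Phi_bar (s + c) - Phi_bar (t + c)"
    using measure_std_normal_shift_le[of "{t<..}" t c] measure_std_normal_shift_ge[of "{s<..t}" t c] assms
    by (simp_all add: Phi_bar_eq_measure[symmetric] Phi_bar_diff[symmetric] g_def)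
  have "Phi_bar (t + c) * (Phi_bar s - Phi_bar t) \<le> g * Phi_bar t * (Phi_bar s - Phi_bar t)"
    using 1 assms by (intro mult_right_mono) (auto simp: Phi_bar_le_iff)
  also have "\<dots> \<le> (Phi_bar (s + c) - Phi_bar (t + c)) * Phi_bar t"
    using 2 Phi_bar_pos[of t] by (auto simp: mult.commute mult.left_commute intro: mult_left_mono)
  finally show ?thesis by (simp add: algebra_simps)
qed

section \<open>The statistic in diagonal coordinates\<close>

text \<open>The spacing statistic as a function of \<open>a = \<bar>x + y\<bar>\<close> and \<open>b = \<bar>x - y\<bar>\<close>: the numerator is evaluated
  at the first knot, since \<open>max \<bar>x\<bar> \<bar>y\<bar> = (a + b) / 2\<close>, and the denominator at the second knot, which no
  longer depends on the variable and the sign that enter first.\<close>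

definition diag_stat :: "real \<Rightarrow> real \<Rightarrow> real \<Rightarrow> real" where
  "diag_stat r a b = Phi_bar ((a + b) / 2) /
     Phi_bar (max ((a - (1 + r) / (1 - r) * b) / 2) ((b - (1 - r) / (1 + r) * a) / 2))"

lemma diag_stat_swap: "diag_stat (- r) b a = diag_stat r a b"
  by (simp add: diag_stat_def max.commute add.commute)

text \<open>When \<open>a\<close> grows by \<open>2 * d\<close>, the first knot grows by exactly \<open>d\<close> and the second by at most \<open>d\<close>.
  In the worst case both move by \<open>d\<close>, and since the second knot is the smaller one, log-concavity of
  the tail makes the ratio decrease.\<close>

lemma diag_stat_antimono:
  assumes "-1 < r" "r < 1" "0 \<le> a" "a \<le> a'" "0 \<le> b"
  shows "diag_stat r a' b \<le> diag_stat r a b"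
proof -
  define k l where "k = (1 + r) / (1 - r)" and "l = (1 - r) / (1 + r)"
  have kl: "k \<ge> 0" "l \<ge> 0" using assms by (auto simp: k_def l_def)
  \<comment> \<open>\<open>m a\<close> is the second knot.\<close>
  define m where "m = (\<lambda>a. max ((a - k * b) / 2) ((b - l * a) / 2))"
  define d where "d = (a' - a) / 2"
  have d: "d \<ge> 0" using assms by (simp add: d_def)
  have "l * a \<le> l * a'" "0 \<le> l * a" "0 \<le> k * b"
    using assms kl by (auto intro: mult_left_mono)
  then have m': "m a' \<le> m a + d" and m: "m a \<le> (a + b) / 2"
    using assms unfolding m_def d_def by (auto simp: max_def field_simps)
  have "Phi_bar ((a' + b) / 2) / Phi_bar (m a') \<le> Phi_bar ((a + b) / 2 + d) / Phi_bar (m a + d)"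
    using m' by (intro frac_le)
      (auto simp: Phi_bar_le_iff Phi_bar_pos Phi_bar_pos[THEN less_imp_le], simp add: d_def field_simps)
  also have "\<dots> \<le> Phi_bar ((a + b) / 2) / Phi_bar (m a)"
    using Phi_bar_shift_ratio_antimono[OF m d] Phi_bar_pos
    by (simp add: pos_divide_le_eq pos_le_divide_eq mult.commute)
  finally show ?thesis by (simp add: diag_stat_def m_def k_def l_def)
qed

text \<open>The plane splits into four sectors according to the leading variable and its sign. In each of them
  the signs of \<open>x + y\<close> and \<open>x - y\<close> are constant; passing to another sector only changes these signs or
  interchanges the two terms of the maximum.\<close>

lemma spacing_stat_diag:
  assumes "-1 < \<rho>" "\<rho> < 1"
  shows "spacing_stat \<rho> (x, y) = diag_stat \<rho> \<bar>x + y\<bar> \<bar>x - y\<bar>"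
proof -
  obtain p where p: "leading (x, y) p" using leading_exists by blast
  obtain i e where ie: "p = (i, e)" by (cases p)
  have i: "i = 1 \<or> i = 2" and e: "e = 1 \<or> e = -1" using p by (auto simp: leading_def ie)
  define k1 k2 where "k1 = (1 + \<rho>) / (1 - \<rho>)" and "k2 = (1 - \<rho>) / (1 + \<rho>)"
  have L: "1 - \<rho> \<noteq> 0" "1 + \<rho> \<noteq> 0" "-1 - \<rho> \<noteq> 0" using assms by auto
  have scores:
    "(v - \<rho> * u) / (1 - \<rho>) = ((u + v) - k1 * (u - v)) / 2"
    "(\<rho> * u - v) / (1 + \<rho>) = ((u - v) - k2 * (u + v)) / 2"
    "(\<rho> * u - v) / (1 - \<rho>) = ((- u - v) - k1 * (v - u)) / 2"
    "(v - \<rho> * u) / (1 + \<rho>) = ((v - u) - k2 * (- u - v)) / 2" for u v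
    using L by (simp_all add: k1_def k2_def divide_simps) (simp_all add: algebra_simps)
  have m: "\<bar>x\<bar> \<le> e * coord (x, y) i" "\<bar>y\<bar> \<le> e * coord (x, y) i"
    using p by (simp_all add: leading_def ie coord_def)
  have "p = (1, 1) \<and> \<bar>y\<bar> \<le> x \<or> p = (1, -1) \<and> \<bar>y\<bar> \<le> -x \<or>
      p = (2, 1) \<and> \<bar>x\<bar> \<le> y \<or> p = (2, -1) \<and> \<bar>x\<bar> \<le> -y"
    using i e m by (elim disjE) (simp_all add: ie coord_def)
  moreover have "\<bar>u + v\<bar> = u + v \<and> \<bar>u - v\<bar> = u - v" if "\<bar>v\<bar> \<le> u" for u v :: real
    using that by linarith
  note this[of y x] this[of "-y" "-x"] this[of x y] this[of "-x" "-y"]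
  ultimately consider "p = (1, 1)" "\<bar>x + y\<bar> = x + y" "\<bar>x - y\<bar> = x - y"
    | "p = (1, -1)" "\<bar>x + y\<bar> = - x - y" "\<bar>x - y\<bar> = y - x"
    | "p = (2, 1)" "\<bar>x + y\<bar> = y + x" "\<bar>x - y\<bar> = y - x"
    | "p = (2, -1)" "\<bar>x + y\<bar> = - y - x" "\<bar>x - y\<bar> = x - y"
    by (elim disjE conjE) (simp_all add: abs_minus_commute add.commute)
  then have "knot1 (x, y) p = (\<bar>x + y\<bar> + \<bar>x - y\<bar>) / 2 \<and> knot2 \<rho> (x, y) p =
      max ((\<bar>x + y\<bar> - k1 * \<bar>x - y\<bar>) / 2) ((\<bar>x - y\<bar> - k2 * \<bar>x + y\<bar>) / 2)"
  proof cases
    case 1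
    have "knot2 \<rho> (x, y) p = max ((y - \<rho> * x) / (1 - \<rho>)) ((\<rho> * x - y) / (1 + \<rho>))"
      by (simp add: 1(1) knot2_def coord_def)
    then show ?thesis
      unfolding 1(2,3) scores by (simp add: 1(1) knot1_def coord_def)
  next
    case 2
    have "knot2 \<rho> (x, y) p = max ((y - \<rho> * x) / (1 + \<rho>)) ((\<rho> * x - y) / (1 - \<rho>))"
      by (simp add: 2(1) knot2_def coord_def)
    also have "\<dots> = max ((\<rho> * x - y) / (1 - \<rho>)) ((y - \<rho> * x) / (1 + \<rho>))"
      by (rule max.commute)
    finally show ?thesis
      unfolding 2(2,3) scores by (simp add: 2(1) knot1_def coord_def)
  next
    case 3
    have "knot2 \<rho> (x, y) p = max ((x - \<rho> * y) / (1 - \<rho>)) ((\<rho> * y - x) / (1 + \<rho>))"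
      by (simp add: 3(1) knot2_def coord_def)
    then show ?thesis
      unfolding 3(2,3) scores by (simp add: 3(1) knot1_def coord_def)
  next
    case 4
    have "knot2 \<rho> (x, y) p = max ((x - \<rho> * y) / (1 + \<rho>)) ((\<rho> * y - x) / (1 - \<rho>))"
      by (simp add: 4(1) knot2_def coord_def)
    also have "\<dots> = max ((\<rho> * y - x) / (1 - \<rho>)) ((x - \<rho> * y) / (1 + \<rho>))"
      by (rule max.commute)
    finally show ?thesis
      unfolding 4(2,3) scores by (simp add: 4(1) knot1_def coord_def)
  qed
  then have knots: "knot1 (x, y) p = (\<bar>x + y\<bar> + \<bar>x - y\<bar>) / 2"
    "knot2 \<rho> (x, y) p = max ((\<bar>x + y\<bar> - k1 * \<bar>x - y\<bar>) / 2) ((\<bar>x - y\<bar> - k2 * \<bar>x + y\<bar>) / 2)"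
    by blast+
  show ?thesis
    unfolding spacing_stat_eq[OF assms p] knots diag_stat_def k1_def k2_def ..
qed

text \<open>Flipping the sign of \<open>y\<close> exchanges the two diagonals and replaces \<open>\<rho>\<close> by \<open>- \<rho>\<close>. The sign \<open>\<epsilon>\<close>
  in this and the following results covers both diagonals at once.\<close>

lemma spacing_stat_diag_sign:
  assumes "-1 < \<rho>" "\<rho> < 1" "\<epsilon> \<in> {1, -1}"
  shows "spacing_stat \<rho> (x, y) = diag_stat (\<epsilon> * \<rho>) \<bar>x + \<epsilon> * y\<bar> \<bar>x - \<epsilon> * y\<bar>"
  using assms by (auto simp: spacing_stat_diag diag_stat_swap)

lemma closed_rejection_region:
  assumes "-1 < \<rho>" "\<rho> < 1"
  shows "closed (rejection_region \<rho> \<alpha>)"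
proof -
  have "rejection_region \<rho> \<alpha> = {z. diag_stat \<rho> \<bar>fst z + snd z\<bar> \<bar>fst z - snd z\<bar> \<le> \<alpha>}"
    using spacing_stat_diag[OF assms] by (auto simp: rejection_region_def)
  moreover have "continuous_on UNIV (\<lambda>z. diag_stat \<rho> \<bar>fst z + snd z\<bar> \<bar>fst z - snd z\<bar>)"
    unfolding diag_stat_def
    by (intro continuous_intros ballI Phi_bar_pos[THEN less_imp_neq, THEN not_sym]) auto
  ultimately show ?thesis by (simp add: closed_Collect_le)
qed

section \<open>Reflections across diagonal lines\<close>

text \<open>The orthogonal reflection across the line \<open>x + \<epsilon> * y = s\<close>, for \<open>\<epsilon> = \<plusminus>1\<close>. For \<open>s = 0\<close> this is
  \<^term>\<open>diag_reflection (- \<epsilon>)\<close>; the shifted lines serve to exchange two different means.\<close>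

definition diag_mirror :: "real \<Rightarrow> real \<Rightarrow> real \<times> real \<Rightarrow> real \<times> real" where
  "diag_mirror \<epsilon> s z = (s - \<epsilon> * snd z, \<epsilon> * (s - fst z))"

lemma diag_mirror_coords:
  assumes "\<epsilon> \<in> {1, -1}"
  shows "fst (diag_mirror \<epsilon> s z) + \<epsilon> * snd (diag_mirror \<epsilon> s z) = 2 * s - (fst z + \<epsilon> * snd z)"
    and "fst (diag_mirror \<epsilon> s z) - \<epsilon> * snd (diag_mirror \<epsilon> s z) = fst z - \<epsilon> * snd z"
  using assms by (auto simp: diag_mirror_def)

lemma diag_mirror_involution:
  assumes "\<epsilon> \<in> {1, -1}" shows "diag_mirror \<epsilon> s (diag_mirror \<epsilon> s z) = z"
  using assms by (cases z) (auto simp: diag_mirror_def)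

lemma measurable_diag_mirror [measurable]: "diag_mirror \<epsilon> s \<in> borel_measurable borel"
  unfolding diag_mirror_def[abs_def] by (intro borel_measurable_continuous_onI continuous_intros)

lemma nn_integral_lborel_pair:
  fixes f :: "real \<times> real \<Rightarrow> ennreal"
  assumes "f \<in> borel_measurable borel"
  shows "(\<integral>\<^sup>+z. f z \<partial>lborel) = (\<integral>\<^sup>+x. \<integral>\<^sup>+y. f (x, y) \<partial>lborel \<partial>lborel)"
    and "(\<integral>\<^sup>+z. f z \<partial>lborel) = (\<integral>\<^sup>+y. \<integral>\<^sup>+x. f (x, y) \<partial>lborel \<partial>lborel)"
proof -
  have f: "f \<in> borel_measurable (lborel \<Otimes>\<^sub>M lborel)" using assms by (simp add: lborel_prod)
  show "(\<integral>\<^sup>+z. f z \<partial>lborel) = (\<integral>\<^sup>+x. \<integral>\<^sup>+y. f (x, y) \<partial>lborel \<partial>lborel)"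
    using lborel.nn_integral_fst[OF f] by (simp add: lborel_prod)
  show "(\<integral>\<^sup>+z. f z \<partial>lborel) = (\<integral>\<^sup>+y. \<integral>\<^sup>+x. f (x, y) \<partial>lborel \<partial>lborel)"
    using lborel_pair.nn_integral_snd[of f] f by (simp add: lborel_prod)
qed

lemma nn_integral_diag_mirror:
  fixes f :: "real \<times> real \<Rightarrow> ennreal"
  assumes [measurable]: "f \<in> borel_measurable borel" and "\<epsilon> \<in> {1, -1}"
  shows "(\<integral>\<^sup>+z. f (diag_mirror \<epsilon> s z) \<partial>lborel) = (\<integral>\<^sup>+z. f z \<partial>lborel)"
proof -
  have [measurable]: "f \<in> borel_measurable (borel \<Otimes>\<^sub>M borel)"
    using assms(1) by (simp add: borel_prod)
  have "(\<integral>\<^sup>+z. f z \<partial>lborel) = (\<integral>\<^sup>+x. \<integral>\<^sup>+y. f (x, y) \<partial>lborel \<partial>lborel)"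
    by (rule nn_integral_lborel_pair) fact
  also have "\<dots> = (\<integral>\<^sup>+v. \<integral>\<^sup>+y. f (s - \<epsilon> * v, y) \<partial>lborel \<partial>lborel)"
    using assms(2) by (subst nn_integral_real_affine[where c = "- \<epsilon>" and t = s]) auto
  also have "\<dots> = (\<integral>\<^sup>+v. \<integral>\<^sup>+u. f (s - \<epsilon> * v, \<epsilon> * (s - u)) \<partial>lborel \<partial>lborel)"
  proof (rule nn_integral_cong)
    fix v
    show "(\<integral>\<^sup>+y. f (s - \<epsilon> * v, y) \<partial>lborel) = (\<integral>\<^sup>+u. f (s - \<epsilon> * v, \<epsilon> * (s - u)) \<partial>lborel)"
      using assms(2)
      by (subst nn_integral_real_affine[where c = "- \<epsilon>" and t = "\<epsilon> * s"]) (auto simp: algebra_simps)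
  qed
  also have "\<dots> = (\<integral>\<^sup>+z. f (diag_mirror \<epsilon> s z) \<partial>lborel)"
    by (subst nn_integral_lborel_pair(2)) (measurable, simp add: diag_mirror_def)
  finally show ?thesis by simp
qed

text \<open>Both variances being equal, \<open>x + y\<close> and \<open>x - y\<close> are uncorrelated: the quadratic form is
  diagonal in these coordinates.\<close>

lemma bivariate_normal_density_diag:
  assumes "\<epsilon> \<in> {1, -1}"
  shows "bivariate_normal_density \<rho> \<mu> z =
     exp (- ((1 - \<epsilon> * \<rho>) * ((fst z + \<epsilon> * snd z) - (fst \<mu> + \<epsilon> * snd \<mu>))\<^sup>2 +
             (1 + \<epsilon> * \<rho>) * ((fst z - \<epsilon> * snd z) - (fst \<mu> - \<epsilon> * snd \<mu>))\<^sup>2) / (4 * (1 - \<rho>\<^sup>2)))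
       / (2 * pi * sqrt (1 - \<rho>\<^sup>2))"
proof -
  define u v where "u = fst z - fst \<mu>" and "v = snd z - snd \<mu>"
  have a: "(fst z + \<epsilon> * snd z) - (fst \<mu> + \<epsilon> * snd \<mu>) = u + \<epsilon> * v"
    "(fst z - \<epsilon> * snd z) - (fst \<mu> - \<epsilon> * snd \<mu>) = u - \<epsilon> * v"
    by (auto simp: u_def v_def algebra_simps)
  have "(1 - \<epsilon> * \<rho>) * (u + \<epsilon> * v)\<^sup>2 + (1 + \<epsilon> * \<rho>) * (u - \<epsilon> * v)\<^sup>2
      = 2 * (u\<^sup>2 - 2 * \<rho> * u * v + v\<^sup>2)"
    using assms by (auto simp: power2_eq_square algebra_simps)
  moreover have "- (2 * q) / (4 * (1 - \<rho>\<^sup>2)) = - q / (2 * (1 - \<rho>\<^sup>2))" for q :: real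
    using mult_divide_mult_cancel_left[of 2 "- q" "2 * (1 - \<rho>\<^sup>2)"] by (simp add: algebra_simps)
  ultimately show ?thesis
    unfolding a bivariate_normal_density_def u_def[symmetric] v_def[symmetric] by (simp only:)
qed

lemma measurable_bivariate_normal_density [measurable]:
  "bivariate_normal_density \<rho> \<mu> \<in> borel_measurable borel"
  unfolding bivariate_normal_density_def[abs_def] divide_inverse
  by (intro borel_measurable_continuous_onI continuous_intros)

lemma emeasure_bivariate_normal:
  assumes "A \<in> sets borel"
  shows "emeasure (bivariate_normal \<rho> \<mu>) A =
    (\<integral>\<^sup>+z. ennreal (bivariate_normal_density \<rho> \<mu> z) * indicator A z \<partial>lborel)"
  unfolding bivariate_normal_def using assms by (subst emeasure_density) auto

lemma prob_space_bivariate_normal: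
  assumes "-1 < \<rho>" "\<rho> < 1"
  shows "prob_space (bivariate_normal \<rho> \<mu>)"
proof
  let ?\<sigma> = "sqrt (1 - \<rho>\<^sup>2)"
  have \<sigma>: "0 < ?\<sigma>" using assms by (simp add: abs_square_less_1)
  have total: "(\<integral>\<^sup>+x. ennreal (normal_density m \<tau> x) \<partial>lborel) = 1" if "0 < \<tau>" for m \<tau>
    using prob_space.emeasure_space_1[OF prob_space_normal_density[OF that, of m]]
    by (simp add: emeasure_density)
  have "emeasure (bivariate_normal \<rho> \<mu>) UNIV =
     (\<integral>\<^sup>+x. \<integral>\<^sup>+y. ennreal (bivariate_normal_density \<rho> \<mu> (x, y)) \<partial>lborel \<partial>lborel)"
    by (simp add: emeasure_bivariate_normal nn_integral_lborel_pair(1))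
  also have "\<dots> = (\<integral>\<^sup>+x. ennreal (normal_density (fst \<mu>) 1 x) *
      (\<integral>\<^sup>+y. ennreal (normal_density (snd \<mu> + \<rho> * (x - fst \<mu>)) ?\<sigma> y) \<partial>lborel) \<partial>lborel)"
    using bivariate_normal_density_factor[OF assms, of "fst \<mu>" "snd \<mu>"]
    by (simp add: ennreal_mult nn_integral_cmult)
  also have "\<dots> = 1" using \<sigma> by (simp add: total)
  finally show "emeasure (bivariate_normal \<rho> \<mu>) (space (bivariate_normal \<rho> \<mu>)) = 1"
    by (simp add: bivariate_normal_def)
qed

section \<open>Monotonicity of the power\<close>

lemma rejection_region_farther:
  assumes "-1 < \<rho>" "\<rho> < 1" "\<epsilon> \<in> {1, -1}"
    and "z \<in> rejection_region \<rho> \<alpha>"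
    and "\<bar>fst z + \<epsilon> * snd z\<bar> \<le> \<bar>fst z' + \<epsilon> * snd z'\<bar>"
    and "\<bar>fst z - \<epsilon> * snd z\<bar> = \<bar>fst z' - \<epsilon> * snd z'\<bar>"
  shows "z' \<in> rejection_region \<rho> \<alpha>"
proof -
  have r: "-1 < \<epsilon> * \<rho>" "\<epsilon> * \<rho> < 1" using assms by auto
  have "spacing_stat \<rho> (fst z', snd z') \<le> spacing_stat \<rho> (fst z, snd z)"
    using diag_stat_antimono[OF r abs_ge_zero assms(5) abs_ge_zero] assms(6)
    by (simp add: spacing_stat_diag_sign[OF assms(1-3)] del: prod.collapse)
  then show ?thesis using assms(4) by (simp add: rejection_region_def)
qed

text \<open>A reflection argument. Take the mirror \<open>T\<close> that exchanges the means \<open>\<mu>\<close> and \<open>\<mu>'\<close>. The set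
  \<open>R \<inter> T R\<close> is symmetric under \<open>T\<close> and has the same probability under both means. A point \<open>z\<close> of \<open>R\<close>
  outside \<open>T R\<close> is farther from the diagonal \<open>x + \<epsilon> * y = 0\<close> than \<open>T z\<close>; then \<open>z\<close> lies on the
  same side of the mirror line as \<open>\<mu>'\<close>, the mean farther from that diagonal, and its density under
  \<open>\<mu>'\<close> is at least the one under \<open>\<mu>\<close>.\<close>

lemma emeasure_bivariate_normal_mono_diag:
  assumes \<rho>: "-1 < \<rho>" "\<rho> < 1" and \<epsilon>: "\<epsilon> \<in> {1, -1}"
    and same: "fst \<mu> - \<epsilon> * snd \<mu> = fst \<mu>' - \<epsilon> * snd \<mu>'"
    and le: "\<bar>fst \<mu> + \<epsilon> * snd \<mu>\<bar> \<le> \<bar>fst \<mu>' + \<epsilon> * snd \<mu>'\<bar>"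
    and [measurable]: "R \<in> sets borel"
    and R: "\<And>z z'. z \<in> R \<Longrightarrow> \<bar>fst z + \<epsilon> * snd z\<bar> \<le> \<bar>fst z' + \<epsilon> * snd z'\<bar> \<Longrightarrow>
      fst z - \<epsilon> * snd z = fst z' - \<epsilon> * snd z' \<Longrightarrow> z' \<in> R"
  shows "emeasure (bivariate_normal \<rho> \<mu>) R \<le> emeasure (bivariate_normal \<rho> \<mu>') R"
proof -
  define m m' where "m = fst \<mu> + \<epsilon> * snd \<mu>" and "m' = fst \<mu>' + \<epsilon> * snd \<mu>'"
  define s where "s = (m + m') / 2"
  define T where "T = diag_mirror \<epsilon> s"
  define p p' where "p = (\<lambda>z. ennreal (bivariate_normal_density \<rho> \<mu> z))"
    and "p' = (\<lambda>z. ennreal (bivariate_normal_density \<rho> \<mu>' z))"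
  have [measurable]: "T \<in> borel_measurable borel" "p \<in> borel_measurable borel" "p' \<in> borel_measurable borel"
    by (simp_all add: T_def p_def p'_def)
  have pT: "p (T z) = p' z" for z
  proof -
    have "(2 * s - (fst z + \<epsilon> * snd z) - m)\<^sup>2 = (fst z + \<epsilon> * snd z - m')\<^sup>2"
      by (simp add: s_def power2_eq_square algebra_simps)
    then show ?thesis
      by (simp add: p_def p'_def T_def bivariate_normal_density_diag[OF \<epsilon>] diag_mirror_coords[OF \<epsilon>] same
          flip: m_def m'_def)
  qed
  have p_le: "p z \<le> p' z" if "z \<in> R" "T z \<notin> R" for z
  proof -
    define a where "a = fst z + \<epsilon> * snd z"
    \<comment> \<open>The mirror image of \<open>z\<close> leaves \<open>R\<close>, so it is strictly closer to the diagonal.\<close>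
    have "\<bar>2 * s - a\<bar> < \<bar>a\<bar>"
      using R[OF that(1), of "T z"] that(2) unfolding T_def diag_mirror_coords[OF \<epsilon>] a_def by linarith
    then have "(2 * s - a)\<^sup>2 < a\<^sup>2" using abs_le_square_iff[of a "2 * s - a"] by linarith
    then have 1: "0 < (m + m') * (2 * a - (m + m'))"
      by (simp add: s_def power2_eq_square algebra_simps)
    have "m\<^sup>2 \<le> m'\<^sup>2" using le by (simp add: m_def m'_def abs_le_square_iff)
    then have 2: "0 \<le> (m' - m) * (m + m')"
      by (simp add: power2_eq_square algebra_simps)
    \<comment> \<open>The factor \<open>2 * a - (m + m')\<close> has the sign of \<open>m + m'\<close>, and \<open>m' - m\<close> is zero or has that sign.\<close>
    have "0 \<le> (m' - m) * (2 * a - (m + m'))"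
      using 1 2 by (auto simp: zero_less_mult_iff zero_le_mult_iff)
    then have 3: "(a - m')\<^sup>2 \<le> (a - m)\<^sup>2"
      by (simp add: power2_eq_square algebra_simps)
    have "0 < 1 - \<rho>\<^sup>2" "0 < 1 - \<epsilon> * \<rho>" using \<rho> \<epsilon> by (auto simp: abs_square_less_1)
    then show ?thesis unfolding p_def p'_def bivariate_normal_density_diag[OF \<epsilon>]
        same m_def[symmetric] m'_def[symmetric] a_def[symmetric]
      using 3 by (intro ennreal_leI divide_right_mono) (auto intro!: divide_right_mono mult_left_mono)
  qed
  have split: "(\<integral>\<^sup>+z. f z * indicator R z \<partial>lborel) =
      (\<integral>\<^sup>+z. f z * indicator {z \<in> R. T z \<in> R} z \<partial>lborel) +
      (\<integral>\<^sup>+z. f z * indicator {z \<in> R. T z \<notin> R} z \<partial>lborel)"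
    if [measurable]: "f \<in> borel_measurable borel" for f :: "real \<times> real \<Rightarrow> ennreal"
    by (subst nn_integral_add[symmetric]) (auto intro!: nn_integral_cong simp: indicator_def)
  have "(\<integral>\<^sup>+z. p z * indicator {z \<in> R. T z \<in> R} z \<partial>lborel) =
      (\<integral>\<^sup>+z. p (T z) * indicator {z \<in> R. T z \<in> R} (T z) \<partial>lborel)"
    unfolding T_def by (rule nn_integral_diag_mirror[OF _ \<epsilon>, symmetric]) (simp flip: T_def)
  also have "\<dots> = (\<integral>\<^sup>+z. p' z * indicator {z \<in> R. T z \<in> R} z \<partial>lborel)"
    by (auto intro!: nn_integral_cong simp: pT[unfolded T_def] indicator_def T_def diag_mirror_involution[OF \<epsilon>])
  finally have "(\<integral>\<^sup>+z. p z * indicator R z \<partial>lborel) \<le> (\<integral>\<^sup>+z. p' z * indicator R z \<partial>lborel)"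
    unfolding split[OF \<open>p \<in> _\<close>] split[OF \<open>p' \<in> _\<close>]
    by (auto intro!: add_mono nn_integral_mono simp: indicator_def p_le)
  then show ?thesis by (simp add: emeasure_bivariate_normal p_def p'_def)
qed

lemma spacing_power_mono_diag:
  assumes \<rho>: "-1 < \<rho>" "\<rho> < 1" and \<epsilon>: "\<epsilon> \<in> {1, -1}"
    and "fst \<mu> - \<epsilon> * snd \<mu> = fst \<mu>' - \<epsilon> * snd \<mu>'"
    and "\<bar>fst \<mu> + \<epsilon> * snd \<mu>\<bar> \<le> \<bar>fst \<mu>' + \<epsilon> * snd \<mu>'\<bar>"
  shows "spacing_power \<rho> \<alpha> \<mu> \<le> spacing_power \<rho> \<alpha> \<mu>'"
proof -
  interpret prob_space "bivariate_normal \<rho> \<mu>'" by (rule prob_space_bivariate_normal[OF \<rho>])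
  have "emeasure (bivariate_normal \<rho> \<mu>) (rejection_region \<rho> \<alpha>)
      \<le> emeasure (bivariate_normal \<rho> \<mu>') (rejection_region \<rho> \<alpha>)"
    using assms closed_rejection_region[OF \<rho>]
    by (intro emeasure_bivariate_normal_mono_diag[OF \<rho> \<epsilon>])
       (auto elim: rejection_region_farther[OF \<rho> \<epsilon>])
  then show ?thesis
    unfolding spacing_power_def measure_def by (intro enn2real_mono) (auto simp: top.not_eq_extremum[symmetric])
qed

text \<open>The mean \<open>\<nu>\<close> has the first diagonal coordinate of \<open>\<mu>'\<close> and the second one of \<open>\<mu>\<close>, so each of
  the two steps moves the mean along one diagonal direction. All monotonicity claims about the power
  are instances of this inequality.\<close>

lemma spacing_power_mono:
  assumes \<rho>: "-1 < \<rho>" "\<rho> < 1"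
    and plus: "\<bar>fst \<mu> + snd \<mu>\<bar> \<le> \<bar>fst \<mu>' + snd \<mu>'\<bar>"
    and minus: "\<bar>fst \<mu> - snd \<mu>\<bar> \<le> \<bar>fst \<mu>' - snd \<mu>'\<bar>"
  shows "spacing_power \<rho> \<alpha> \<mu> \<le> spacing_power \<rho> \<alpha> \<mu>'"
proof -
  define \<nu> where "\<nu> = ((fst \<mu>' + snd \<mu>' + (fst \<mu> - snd \<mu>)) / 2, (fst \<mu>' + snd \<mu>' - (fst \<mu> - snd \<mu>)) / 2)"
  have \<nu>: "fst \<nu> + snd \<nu> = fst \<mu>' + snd \<mu>'" "fst \<nu> - snd \<nu> = fst \<mu> - snd \<mu>"
    by (simp_all add: \<nu>_def field_simps)
  have "spacing_power \<rho> \<alpha> \<mu> \<le> spacing_power \<rho> \<alpha> \<nu>"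
    using plus by (intro spacing_power_mono_diag[OF \<rho>, of 1]) (simp_all add: \<nu>)
  also have "\<dots> \<le> spacing_power \<rho> \<alpha> \<mu>'"
    using minus by (intro spacing_power_mono_diag[OF \<rho>, of "-1"]) (simp_all add: \<nu>)
  finally show ?thesis .
qed

section \<open>The level under the null hypothesis\<close>

lemma emeasure_bivariate_normal_line:
  assumes "\<epsilon> \<in> {1, -1 :: real}"
  shows "emeasure (bivariate_normal \<rho> \<mu>) {z. fst z + \<epsilon> * snd z = 0} = 0"
proof -
  have "negligible {z :: real \<times> real. (1, \<epsilon>) \<bullet> z = 0}"
    by (intro negligible_hyperplane) (simp add: zero_prod_def)
  also have "{z :: real \<times> real. (1, \<epsilon>) \<bullet> z = 0} = {z. fst z + \<epsilon> * snd z = 0}"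
    by (auto simp: inner_prod_def)
  finally have "{z. fst z + \<epsilon> * snd z = 0} \<in> null_sets lebesgue"
    by (simp add: negligible_iff_null_sets)
  moreover have c: "{z. fst z + \<epsilon> * snd z = 0} \<in> sets borel"
    by (intro borel_closed closed_Collect_eq continuous_intros)
  ultimately have "{z. fst z + \<epsilon> * snd z = 0} \<in> null_sets lborel"
    by (simp add: null_sets_def)
  then show ?thesis
    unfolding emeasure_bivariate_normal[OF c] by (rule nn_integral_null_set)
qed

lemma emeasure_bivariate_normal_half:
  assumes \<rho>: "-1 < \<rho>" "\<rho> < 1" and \<epsilon>: "\<epsilon> \<in> {1, -1}"
    and [measurable]: "R \<in> sets borel"
    and R: "\<And>z. z \<in> R \<Longrightarrow> diag_mirror \<epsilon> 0 z \<in> R"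
  shows "emeasure (bivariate_normal \<rho> 0) R =
    2 * emeasure (bivariate_normal \<rho> 0) (R \<inter> {z. 0 < fst z + \<epsilon> * snd z})"
proof -
  let ?P = "emeasure (bivariate_normal \<rho> 0)" and ?A = "\<lambda>z. fst z + \<epsilon> * snd z"
  have [measurable]: "{z. 0 < ?A z} \<in> sets borel" "{z. ?A z < 0} \<in> sets borel" "{z. ?A z = 0} \<in> sets borel"
    by (intro borel_open borel_closed open_Collect_less closed_Collect_eq continuous_intros)+
  have s: "sets (bivariate_normal \<rho> 0) = sets borel" by (simp add: bivariate_normal_def)
  have iff: "diag_mirror \<epsilon> 0 z \<in> R \<longleftrightarrow> z \<in> R" for z
    using R[of z] R[of "diag_mirror \<epsilon> 0 z"] by (auto simp: diag_mirror_involution[OF \<epsilon>])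
  have p: "bivariate_normal_density \<rho> 0 (diag_mirror \<epsilon> 0 z) = bivariate_normal_density \<rho> 0 z" for z
    by (simp add: bivariate_normal_density_diag[OF \<epsilon>] diag_mirror_coords[OF \<epsilon>] power2_commute)
       (simp add: power2_eq_square algebra_simps)
  have "?P (R \<inter> {z. ?A z < 0}) =
      (\<integral>\<^sup>+z. ennreal (bivariate_normal_density \<rho> 0 z) * indicator (R \<inter> {z. ?A z < 0}) z \<partial>lborel)"
    by (rule emeasure_bivariate_normal) measurable
  also have "\<dots> = (\<integral>\<^sup>+z. ennreal (bivariate_normal_density \<rho> 0 (diag_mirror \<epsilon> 0 z)) *
      indicator (R \<inter> {z. ?A z < 0}) (diag_mirror \<epsilon> 0 z) \<partial>lborel)"
    by (rule nn_integral_diag_mirror[OF _ \<epsilon>, symmetric]) measurable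
  also have "\<dots> = ?P (R \<inter> {z. 0 < ?A z})"
    by (subst emeasure_bivariate_normal)
       (auto intro!: nn_integral_cong simp: indicator_def p iff diag_mirror_coords[OF \<epsilon>])
  finally have half: "?P (R \<inter> {z. ?A z < 0}) = ?P (R \<inter> {z. 0 < ?A z})" .
  have "?P (R \<inter> {z. ?A z = 0}) \<le> ?P {z. ?A z = 0}"
    by (rule emeasure_mono) (auto simp: s)
  then have null: "?P (R \<inter> {z. ?A z = 0}) = 0"
    using emeasure_bivariate_normal_line[OF \<epsilon>] by simp
  have "?P R = ?P ((R \<inter> {z. 0 < ?A z}) \<union> ((R \<inter> {z. ?A z < 0}) \<union> (R \<inter> {z. ?A z = 0})))"
    by (rule arg_cong[where f = ?P]) auto
  also have "\<dots> = ?P (R \<inter> {z. 0 < ?A z}) + ?P ((R \<inter> {z. ?A z < 0}) \<union> (R \<inter> {z. ?A z = 0}))"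
    by (rule plus_emeasure[symmetric]) (auto simp: s)
  also have "?P ((R \<inter> {z. ?A z < 0}) \<union> (R \<inter> {z. ?A z = 0})) =
      ?P (R \<inter> {z. ?A z < 0}) + ?P (R \<inter> {z. ?A z = 0})"
    by (rule plus_emeasure[symmetric]) (auto simp: s)
  finally show ?thesis by (simp add: half null mult_2)
qed

text \<open>The two diagonals cut the plane into four congruent sectors of equal null probability, so an
  event with the symmetries of the statistic can be studied in the sector where the first variable
  enters first with positive sign.\<close>

lemma emeasure_bivariate_normal_quarter:
  assumes \<rho>: "-1 < \<rho>" "\<rho> < 1"
    and R: "R \<in> sets borel"
    and inv: "\<And>\<epsilon> z. \<epsilon> \<in> {1, -1} \<Longrightarrow> z \<in> R \<Longrightarrow> diag_mirror \<epsilon> 0 z \<in> R"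
  shows "emeasure (bivariate_normal \<rho> 0) R =
    4 * emeasure (bivariate_normal \<rho> 0) (R \<inter> {z. \<bar>snd z\<bar> < fst z})"
proof -
  let ?P = "emeasure (bivariate_normal \<rho> 0)"
  let ?H = "R \<inter> {z. 0 < fst z + 1 * snd z}"
  have "?P R = 2 * ?P ?H"
    by (rule emeasure_bivariate_normal_half[OF \<rho> _ R inv]) auto
  also have "?P ?H = 2 * ?P (?H \<inter> {z. 0 < fst z + -1 * snd z})"
  proof (rule emeasure_bivariate_normal_half[OF \<rho>])
    have "open {z :: real \<times> real. 0 < fst z + 1 * snd z}"
      by (intro open_Collect_less continuous_intros)
    then show "?H \<in> sets borel" using R by auto
    show "diag_mirror (-1) 0 z \<in> ?H" if "z \<in> ?H" for z
      using that inv[of "-1" z] by (simp add: diag_mirror_def)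
  qed simp
  also have "?H \<inter> {z. 0 < fst z + -1 * snd z} = R \<inter> {z. \<bar>snd z\<bar> < fst z}"
    by auto
  finally show ?thesis by (simp flip: mult.assoc)
qed

text \<open>Under the null hypothesis \<open>x\<close> is standard normal and independent of the residual
  \<open>w = y - \<rho> * x\<close>, which allows conditioning on \<open>w\<close>.\<close>

lemma emeasure_bivariate_normal_regression:
  assumes "-1 < \<rho>" "\<rho> < 1" and [measurable]: "A \<in> sets borel"
  shows "emeasure (bivariate_normal \<rho> 0) A =
    (\<integral>\<^sup>+w. ennreal (normal_density 0 (sqrt (1 - \<rho>\<^sup>2)) w) *
       emeasure std_normal_distribution {x. (x, w + \<rho> * x) \<in> A} \<partial>lborel)"
proof -
  let ?\<sigma> = "sqrt (1 - \<rho>\<^sup>2)"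
  have [measurable]: "A \<in> sets (borel \<Otimes>\<^sub>M borel)"
    using assms(3) unfolding borel_prod .
  have "emeasure (bivariate_normal \<rho> 0) A =
     (\<integral>\<^sup>+x. \<integral>\<^sup>+y. ennreal (bivariate_normal_density \<rho> 0 (x, y)) * indicator A (x, y) \<partial>lborel \<partial>lborel)"
    by (simp add: emeasure_bivariate_normal nn_integral_lborel_pair(1))
  also have "\<dots> = (\<integral>\<^sup>+x. \<integral>\<^sup>+y. ennreal (normal_density 0 1 x) *
      ennreal (normal_density (\<rho> * x) ?\<sigma> y) * indicator A (x, y) \<partial>lborel \<partial>lborel)"
    using bivariate_normal_density_factor[OF assms(1,2), of 0 0]
    by (simp add: zero_prod_def ennreal_mult)
  also have "\<dots> = (\<integral>\<^sup>+x. \<integral>\<^sup>+w. ennreal (normal_density 0 1 x) *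
      ennreal (normal_density 0 ?\<sigma> w) * indicator A (x, w + \<rho> * x) \<partial>lborel \<partial>lborel)"
  proof (rule nn_integral_cong)
    fix x
    show "(\<integral>\<^sup>+y. ennreal (normal_density 0 1 x) * ennreal (normal_density (\<rho> * x) ?\<sigma> y) *
        indicator A (x, y) \<partial>lborel) = (\<integral>\<^sup>+w. ennreal (normal_density 0 1 x) *
        ennreal (normal_density 0 ?\<sigma> w) * indicator A (x, w + \<rho> * x) \<partial>lborel)"
      by (subst nn_integral_real_affine[where c = 1 and t = "\<rho> * x"])
         (simp_all add: normal_density_def add.commute)
  qed
  also have "\<dots> = (\<integral>\<^sup>+w. \<integral>\<^sup>+x. ennreal (normal_density 0 1 x) *
      ennreal (normal_density 0 ?\<sigma> w) * indicator A (x, w + \<rho> * x) \<partial>lborel \<partial>lborel)"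
    by (rule lborel_pair.Fubini') measurable
  also have "\<dots> = (\<integral>\<^sup>+w. ennreal (normal_density 0 ?\<sigma> w) *
       emeasure std_normal_distribution {x. (x, w + \<rho> * x) \<in> A} \<partial>lborel)"
  proof (intro nn_integral_cong)
    fix w
    have [measurable]: "{x. (x, w + \<rho> * x) \<in> A} \<in> sets borel" by measurable
    show "(\<integral>\<^sup>+x. ennreal (normal_density 0 1 x) *
        ennreal (normal_density 0 ?\<sigma> w) * indicator A (x, w + \<rho> * x) \<partial>lborel) =
        ennreal (normal_density 0 ?\<sigma> w) * emeasure std_normal_distribution {x. (x, w + \<rho> * x) \<in> A}"
      by (subst emeasure_std_normal, simp, subst nn_integral_cmult[symmetric])
         (auto intro!: nn_integral_cong simp: indicator_def mult.commute)
  qed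
  finally show ?thesis .
qed

text \<open>In this sector the second knot \<open>l w\<close> depends on the residual \<open>w = y - \<rho> * x\<close> alone, and the
  sector itself is the event \<open>l w < x\<close>. Given \<open>w\<close>, the first knot \<open>x\<close> is therefore a standard normal
  variable conditioned to exceed the second, and its conditional tail probability is uniform.\<close>

lemma emeasure_rejection_sector:
  assumes \<rho>: "-1 < \<rho>" "\<rho> < 1" and \<alpha>: "0 < \<alpha>" "\<alpha> < 1"
  shows "emeasure (bivariate_normal \<rho> 0) (rejection_region \<rho> \<alpha> \<inter> {z. \<bar>snd z\<bar> < fst z}) =
    ennreal \<alpha> * emeasure (bivariate_normal \<rho> 0) {z. \<bar>snd z\<bar> < fst z}"
proof -
  interpret N: prob_space std_normal_distribution by (rule prob_space_std_normal)
  let ?D = "{z :: real \<times> real. \<bar>snd z\<bar> < fst z}"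
  define l where "l w = max (w / (1 - \<rho>)) (- w / (1 + \<rho>))" for w
  have D: "?D \<in> sets borel"
    by (intro borel_open open_Collect_less continuous_intros)
  have sector: "(x, w + \<rho> * x) \<in> ?D \<longleftrightarrow> l w < x" for w x
  proof -
    have "(x, w + \<rho> * x) \<in> ?D \<longleftrightarrow> w < x * (1 - \<rho>) \<and> - w < x * (1 + \<rho>)"
      by (auto simp: algebra_simps abs_less_iff)
    also have "\<dots> \<longleftrightarrow> l w < x"
      unfolding l_def max_less_iff_conj using \<rho> by (subst (1 2) pos_divide_less_eq) simp_all
    finally show ?thesis .
  qed
  have stat: "spacing_stat \<rho> (x, w + \<rho> * x) = Phi_bar x / Phi_bar (l w)" if "l w < x" for w x
  proof -
    have "leading (x, w + \<rho> * x) (1, 1)"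
      using that unfolding sector[symmetric] by (simp add: leading_def coord_def)
    then show ?thesis
      by (simp add: spacing_stat_eq[OF \<rho>] knot1_def knot2_def coord_def l_def)
  qed
  have reject: "{x. (x, w + \<rho> * x) \<in> rejection_region \<rho> \<alpha> \<inter> ?D} =
      {x. l w < x \<and> Phi_bar x \<le> \<alpha> * Phi_bar (l w)}" for w
    unfolding Int_iff sector
    by (auto simp: rejection_region_def stat pos_divide_le_eq Phi_bar_pos)
  have accept: "emeasure std_normal_distribution {x. (x, w + \<rho> * x) \<in> ?D} = Phi_bar (l w)" for w
    unfolding sector by (simp add: Phi_bar_eq_measure N.emeasure_eq_measure greaterThan_def)
  have "emeasure (bivariate_normal \<rho> 0) (rejection_region \<rho> \<alpha> \<inter> ?D) =
      (\<integral>\<^sup>+w. ennreal \<alpha> * (ennreal (normal_density 0 (sqrt (1 - \<rho>\<^sup>2)) w) * ennreal (Phi_bar (l w))) \<partial>lborel)"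
  proof (subst emeasure_bivariate_normal_regression[OF \<rho>])
    show "rejection_region \<rho> \<alpha> \<inter> ?D \<in> sets borel"
      using D closed_rejection_region[OF \<rho>] by auto
    have "emeasure std_normal_distribution {x. l w < x \<and> Phi_bar x \<le> \<alpha> * Phi_bar (l w)} =
        ennreal (\<alpha> * Phi_bar (l w))" for w
      using \<alpha> Phi_bar_pos[of "l w"] by (intro emeasure_std_normal_Phi_bar_le) auto
    then show "(\<integral>\<^sup>+w. ennreal (normal_density 0 (sqrt (1 - \<rho>\<^sup>2)) w) * emeasure std_normal_distribution
        {x. (x, w + \<rho> * x) \<in> rejection_region \<rho> \<alpha> \<inter> ?D} \<partial>lborel) =
      (\<integral>\<^sup>+w. ennreal \<alpha> * (ennreal (normal_density 0 (sqrt (1 - \<rho>\<^sup>2)) w) * ennreal (Phi_bar (l w))) \<partial>lborel)"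
      unfolding reject using \<alpha> Phi_bar_pos
      by (intro nn_integral_cong) (simp add: ennreal_mult less_imp_le mult.left_commute)
  qed
  also have "\<dots> = ennreal \<alpha> * emeasure (bivariate_normal \<rho> 0) ?D"
  proof -
    have [measurable]: "l \<in> borel_measurable borel" unfolding l_def[abs_def] by measurable
    have [measurable]: "Phi_bar \<in> borel_measurable borel"
      by (intro borel_measurable_continuous_onI continuous_intros)
    show ?thesis
      unfolding emeasure_bivariate_normal_regression[OF \<rho> D] accept by (subst nn_integral_cmult) auto
  qed
  finally show ?thesis .
qed

lemma diag_mirror_rejection_region:
  assumes "-1 < \<rho>" "\<rho> < 1" "\<epsilon> \<in> {1, -1}" "z \<in> rejection_region \<rho> \<alpha>"
  shows "diag_mirror \<epsilon> 0 z \<in> rejection_region \<rho> \<alpha>"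
  by (rule rejection_region_farther[OF assms]) (simp_all add: diag_mirror_coords[OF assms(3)])

text \<open>The common factor, the null probability \<open>1/4\<close> of the sector, cancels against the one in
  the total mass.\<close>

lemma spacing_power_null:
  assumes \<rho>: "-1 < \<rho>" "\<rho> < 1" and \<alpha>: "0 < \<alpha>" "\<alpha> < 1"
  shows "spacing_power \<rho> \<alpha> 0 = \<alpha>"
proof -
  interpret prob_space "bivariate_normal \<rho> 0" by (rule prob_space_bivariate_normal[OF \<rho>])
  let ?P = "emeasure (bivariate_normal \<rho> 0)" and ?D = "{z :: real \<times> real. \<bar>snd z\<bar> < fst z}"
  have "1 = ?P UNIV" using emeasure_space_1 by (simp add: bivariate_normal_def)
  also have "\<dots> = 4 * ?P ?D"
    using emeasure_bivariate_normal_quarter[OF \<rho>, of UNIV] by simp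
  finally have total: "4 * ?P ?D = 1" ..
  have "?P (rejection_region \<rho> \<alpha>) = 4 * ?P (rejection_region \<rho> \<alpha> \<inter> ?D)"
    using closed_rejection_region[OF \<rho>] diag_mirror_rejection_region[OF \<rho>]
    by (intro emeasure_bivariate_normal_quarter[OF \<rho>]) auto
  also have "\<dots> = ennreal \<alpha> * (4 * ?P ?D)"
    unfolding emeasure_rejection_sector[OF \<rho> \<alpha>] by (rule mult.left_commute)
  also have "\<dots> = ennreal \<alpha>" unfolding total by simp
  finally show ?thesis using \<alpha> by (simp add: spacing_power_def measure_def)
qed

section \<open>Shape of the acceptance region and the main result\<close>

lemma diag_reflection_rejection_region:
  assumes "-1 < \<rho>" "\<rho> < 1" "\<epsilon> \<in> {1, -1}"
  shows "diag_reflection \<epsilon> ` (- rejection_region \<rho> \<alpha>) = - rejection_region \<rho> \<alpha>"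
proof -
  have eq: "diag_reflection \<epsilon> = diag_mirror (- \<epsilon>) 0"
    by (auto simp: diag_reflection_def diag_mirror_def fun_eq_iff)
  have e: "- \<epsilon> \<in> {1, -1}" using assms by auto
  have iff: "diag_mirror (- \<epsilon>) 0 z \<in> rejection_region \<rho> \<alpha> \<longleftrightarrow> z \<in> rejection_region \<rho> \<alpha>" for z
    using diag_mirror_rejection_region[OF assms(1,2) e] diag_mirror_involution[OF e] by metis
  show ?thesis
  proof (intro equalityI subsetI)
    fix z assume "z \<in> - rejection_region \<rho> \<alpha>"
    then have "z = diag_reflection \<epsilon> (diag_mirror (- \<epsilon>) 0 z)" "diag_mirror (- \<epsilon>) 0 z \<in> - rejection_region \<rho> \<alpha>"
      by (simp_all only: eq diag_mirror_involution[OF e] Compl_iff iff) auto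
    then show "z \<in> diag_reflection \<epsilon> ` (- rejection_region \<rho> \<alpha>)" by (rule image_eqI)
  qed (auto simp: eq iff)
qed

text \<open>Along such a line \<open>x - \<epsilon> * y\<close> is constant and \<open>x + \<epsilon> * y\<close> is affine in \<open>x\<close>, so
  \<open>\<bar>x + \<epsilon> * y\<bar>\<close> at a point between \<open>a\<close> and \<open>b\<close> is at most its larger end value.\<close>

lemma is_interval_acceptance_diag_line:
  assumes "-1 < \<rho>" "\<rho> < 1" "\<epsilon> \<in> {1, -1}"
  shows "is_interval (fst ` (- rejection_region \<rho> \<alpha> \<inter> diag_line \<epsilon> u))"
proof -
  have "fst ` (- rejection_region \<rho> \<alpha> \<inter> diag_line \<epsilon> u) = {x. (x, \<epsilon> * x + u) \<notin> rejection_region \<rho> \<alpha>}"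
    by (force simp: diag_line_def)
  moreover have "(x, \<epsilon> * x + u) \<notin> rejection_region \<rho> \<alpha>"
    if out: "(a, \<epsilon> * a + u) \<notin> rejection_region \<rho> \<alpha>" "(b, \<epsilon> * b + u) \<notin> rejection_region \<rho> \<alpha>"
      and "a \<le> x" "x \<le> b" for a b x
  proof
    assume x: "(x, \<epsilon> * x + u) \<in> rejection_region \<rho> \<alpha>"
    have sum: "t + \<epsilon> * (\<epsilon> * t + u) = 2 * t + \<epsilon> * u" "t - \<epsilon> * (\<epsilon> * t + u) = - \<epsilon> * u" for t
      using assms(3) by (auto simp: algebra_simps)
    have "\<bar>2 * x + \<epsilon> * u\<bar> \<le> \<bar>2 * a + \<epsilon> * u\<bar> \<or> \<bar>2 * x + \<epsilon> * u\<bar> \<le> \<bar>2 * b + \<epsilon> * u\<bar>"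
      using that(3,4) by linarith
    then show False
      using out rejection_region_farther[OF assms x] by (auto simp: sum)
  qed
  ultimately show ?thesis unfolding is_interval_1 by blast
qed

theorem corollary2:
  fixes \<rho> \<alpha> :: real
  assumes "-1 < \<rho>" "\<rho> < 1" "0 < \<alpha>" "\<alpha> < 1"
  shows
    "(\<forall>\<epsilon>\<in>{1, -1}. diag_reflection \<epsilon> ` (- rejection_region \<rho> \<alpha>) = - rejection_region \<rho> \<alpha>) \<and>
     (\<forall>u. \<forall>\<epsilon>\<in>{1, -1}. is_interval (fst ` (- rejection_region \<rho> \<alpha> \<inter> diag_line \<epsilon> u))) \<and>
     (\<forall>u. (\<forall>z\<ge>0. spacing_power \<rho> \<alpha> (u / 2 - z, u / 2 + z) = spacing_power \<rho> \<alpha> (u / 2 + z, u / 2 - z)) \<and>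
          mono_on {0..} (\<lambda>z. spacing_power \<rho> \<alpha> (u / 2 - z, u / 2 + z)) \<and>
          (\<forall>z\<ge>0. spacing_power \<rho> \<alpha> (u / 2 + z, - u / 2 + z) = spacing_power \<rho> \<alpha> (u / 2 - z, - u / 2 - z)) \<and>
          mono_on {0..} (\<lambda>z. spacing_power \<rho> \<alpha> (u / 2 + z, - u / 2 + z))) \<and>
     (\<forall>\<mu>. \<mu> \<noteq> 0 \<longrightarrow> spacing_power \<rho> \<alpha> \<mu> \<ge> \<alpha>) \<and>
     (\<forall>\<mu>. mono_on {0..} (\<lambda>t. spacing_power \<rho> \<alpha> (t *\<^sub>R \<mu>)))"
proof (intro conjI allI ballI impI)
  note mono = spacing_power_mono[OF assms(1,2)]
  show "spacing_power \<rho> \<alpha> (u / 2 - z, u / 2 + z) = spacing_power \<rho> \<alpha> (u / 2 + z, u / 2 - z)" for u z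
    by (rule antisym; rule mono) simp_all
  show "mono_on {0..} (\<lambda>z. spacing_power \<rho> \<alpha> (u / 2 - z, u / 2 + z))" for u
    by (rule mono_onI, rule mono) simp_all
  show "spacing_power \<rho> \<alpha> (u / 2 + z, - u / 2 + z) = spacing_power \<rho> \<alpha> (u / 2 - z, - u / 2 - z)" for u z
    by (rule antisym; rule mono) simp_all
  show "mono_on {0..} (\<lambda>z. spacing_power \<rho> \<alpha> (u / 2 + z, - u / 2 + z))" for u
    by (rule mono_onI, rule mono) simp_all
  show "\<alpha> \<le> spacing_power \<rho> \<alpha> \<mu>" for \<mu>
    using mono[of 0 \<mu> \<alpha>] by (simp add: spacing_power_null[OF assms])
  show "mono_on {0..} (\<lambda>t. spacing_power \<rho> \<alpha> (t *\<^sub>R \<mu>))" for \<mu>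
    by (rule mono_onI, rule mono)
       (simp_all add: abs_mult mult_right_mono flip: distrib_left right_diff_distrib)
qed (simp_all add: assms diag_reflection_rejection_region is_interval_acceptance_diag_line)

end
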